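(* Let $q$ be a prime power, let $d$ be a positive divisor of $q^2-1$, let $r$ be a positive integer and let $\phi(x)\in\mathbb{F}_{q^2}[x]$. Let $a,b,c,u,v\in\mathbb{F}_{q^2}$ satisfy $ab\neq 0$, $a^{q+1}=b^{q+1}$ and $ac^{q}=b^{q}c$. Put $A=bu-av$, $B=au^{q}-bv^{q}$ and $S=\{ax^q+bx+c \mid x\in\mathbb{F}_{q^2}\}$. Then the polynomial $$f(x)=(ax^{q}+bx+c)^r\,\phi\big((ax^{q}+bx+c)^{(q^2-1)/d}\big)+ux^{q}+vx$$ is a permutation polynomial of $\mathbb{F}_{q^2}$ if and only if $g(x)$ permutes $S$, where $$g(x)=x^r\Big[B\,\phi\big(x^{(q^2-1)/d}\big)+A^{1-r}B^{qr}\,\phi\big(x^{(q^2-1)/d}\big)^{q}\Big]+(u^{q+1}-v^{q+1})x.$$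
   Context: A polynomial is a permutation polynomial of $\mathbb{F}_{q^2}$ if the map it induces on $\mathbb{F}_{q^2}$ is a bijection. A polynomial $g$ permutes a subset $S\subseteq\mathbb{F}_{q^2}$ if the map $y\mapsto g(y)$ restricts to a bijection from $S$ to $S$. Convention: under the hypotheses, if $A=0$ then $B=0$, and in that case the term $A^{1-r}B^{qr}$ is read as $0$. *)

theory Defs
  imports "HOL-Library.Cardinality" "HOL-Number_Theory.Prime_Powers" "HOL-Computational_Algebra.Polynomial"
begin

definition permutes_set :: "'a::comm_semiring_0 poly \<Rightarrow> 'a set \<Rightarrow> bool" where
  "permutes_set g S \<longleftrightarrow> bij_betw (poly g) S S"

definition permutation_polynomial :: "'a::{finite, field} poly \<Rightarrow> bool" where
  "permutation_polynomial f \<longleftrightarrow> bij (poly f)"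

end

theory Submission
  imports Defs
begin

text \<open>
  Write \<open>\<sigma> x = x\<^sup>q\<close>, a nontrivial field involution, \<open>L x = a \<sigma>(x) + b x + c\<close>, \<open>N = u \<sigma>(u) - v \<sigma>(v)\<close>
  and \<open>\<psi> z = B z + A \<sigma>(z) + N c\<close>. Then \<open>\<psi> \<circ> f = g \<circ> L\<close>. The image \<open>S\<close> of \<open>L\<close> is the \<open>\<sigma>\<close>-fixed line
  \<open>{y. a \<sigma>(y) = \<sigma>(b) y}\<close>, and on it \<open>A\<^sup>1\<^sup>-\<^sup>r B\<^sup>q\<^sup>r y\<^sup>r = A \<sigma>(y)\<^sup>r\<close>. If \<open>A \<noteq> 0\<close>, then \<open>\<psi>\<close> also maps onto
  \<open>S\<close>, while \<open>f\<close> is injective on every fibre of \<open>L\<close>, so \<open>f\<close> is bijective iff \<open>g\<close> is bijective on \<open>S\<close>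
  (the criterion of Akbary, Ghioca and Wang). If \<open>A = 0\<close>, then \<open>f\<close> is constant on translates by the
  nonzero kernel of \<open>a \<sigma>(x) + b x\<close>, and \<open>g\<close> vanishes on \<open>S\<close>, so neither side holds.
\<close>

section \<open>Semilinear maps over a field with a nontrivial involution\<close>

locale field_involution =
  fixes \<sigma> :: "'a::field \<Rightarrow> 'a"
  assumes add [simp]: "\<sigma> (x + y) = \<sigma> x + \<sigma> y"
    and mult [simp]: "\<sigma> (x * y) = \<sigma> x * \<sigma> y"
    and invol [simp]: "\<sigma> (\<sigma> x) = x"
    and nontrivial: "\<exists>w. \<sigma> w \<noteq> w"
begin

lemma zero [simp]: "\<sigma> 0 = 0"
  by (metis add add_0 add_cancel_right_right)

lemma one [simp]: "\<sigma> 1 = 1"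
  by (metis invol mult mult.right_neutral mult_1)

lemma minus [simp]: "\<sigma> (- x) = - \<sigma> x"
  using add[of x "- x"] by (simp add: eq_neg_iff_add_eq_0 add.commute)

lemma diff [simp]: "\<sigma> (x - y) = \<sigma> x - \<sigma> y"
  using add[of x "- y"] by simp

lemma eq_0_iff [simp]: "\<sigma> x = 0 \<longleftrightarrow> x = 0"
  by (metis invol zero)

lemma divide [simp]: "\<sigma> (x / y) = \<sigma> x / \<sigma> y"
proof (cases "y = 0")
  case False
  then show ?thesis
    using mult[of "x / y" y] by (simp add: field_simps)
qed simp

lemma trace_one: "\<exists>e. e + \<sigma> e = 1"
proof -
  have "\<exists>t. t + \<sigma> t \<noteq> 0"
  proof (rule ccontr)
    assume "\<not> ?thesis"
    then have neg: "\<sigma> t = - t" for t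
      by (metis add_eq_0_iff)
    obtain w where "\<sigma> w \<noteq> w"
      using nontrivial by blast
    moreover have "- 1 = (1 :: 'a)"
      using neg[of 1] by simp
    ultimately show False
      using neg[of w] mult_minus1[of w] by simp
  qed
  then obtain t where t: "t + \<sigma> t \<noteq> 0"
    by blast
  have "t / (t + \<sigma> t) + \<sigma> (t / (t + \<sigma> t)) = t / (t + \<sigma> t) + \<sigma> t / (t + \<sigma> t)"
    by (simp add: add.commute)
  also have "\<dots> = 1"
    using t by (simp flip: add_divide_distrib)
  finally show ?thesis
    by blast
qed

lemma kernel_nontrivial:
  assumes "p \<noteq> 0" and "p * \<sigma> p = p' * \<sigma> p'"
  shows "\<exists>x. x \<noteq> 0 \<and> p * \<sigma> x + p' * x = 0"
proof -
  \<comment> \<open>Otherwise \<open>w = 1\<close> gives \<open>p = \<sigma> p'\<close>, and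
    cancelling \<open>p\<close> makes \<open>\<sigma>\<close> the identity.\<close>
  obtain w where w: "p * \<sigma> w - \<sigma> p' * w \<noteq> 0"
    using \<open>p \<noteq> 0\<close> nontrivial
    by (metis mult.right_neutral mult_left_cancel one right_minus_eq)
  have "p * \<sigma> (p * \<sigma> w - \<sigma> p' * w) + p' * (p * \<sigma> w - \<sigma> p' * w) = (p * \<sigma> p - p' * \<sigma> p') * w"
    by (simp add: algebra_simps)
  also have "\<dots> = 0"
    using assms(2) by simp
  finally show ?thesis
    using w by blast
qed

text \<open>Following the map by \<open>y \<mapsto> p * \<sigma> y - \<sigma> p' * y\<close>
  multiplies by the difference of norms, which is 0. Conversely, an element \<open>e\<close> of
  trace 1 gives the preimage \<open>e * y / p'\<close>: its two terms are
  \<open>\<sigma> e * y\<close> and \<open>e * y\<close>.\<close>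

lemma range_eq_line:
  assumes "p' \<noteq> 0" and norm: "p * \<sigma> p = p' * \<sigma> p'"
  shows "range (\<lambda>x. p * \<sigma> x + p' * x) = {y. p * \<sigma> y = \<sigma> p' * y}"
proof (intro equalityI subsetI)
  fix y assume "y \<in> {y. p * \<sigma> y = \<sigma> p' * y}"
  then have y: "p * \<sigma> y = \<sigma> p' * y"
    by simp
  obtain e where e: "e + \<sigma> e = 1"
    using trace_one by blast
  have "p * \<sigma> (e * y / p') = \<sigma> e * (p * \<sigma> y) / \<sigma> p'"
    by simp
  also have "\<dots> = \<sigma> e * y"
    using \<open>p' \<noteq> 0\<close> by (simp add: y)
  finally have "p * \<sigma> (e * y / p') + p' * (e * y / p') = (e + \<sigma> e) * y"
    using \<open>p' \<noteq> 0\<close> by (simp add: algebra_simps)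
  then show "y \<in> range (\<lambda>x. p * \<sigma> x + p' * x)"
    unfolding e by (intro range_eqI[of _ _ "e * y / p'"]) simp
next
  fix y assume "y \<in> range (\<lambda>x. p * \<sigma> x + p' * x)"
  then obtain x where x: "y = p * \<sigma> x + p' * x"
    by blast
  have "p * \<sigma> y - \<sigma> p' * y = (p * \<sigma> p - p' * \<sigma> p') * x"
    by (simp add: x algebra_simps)
  with norm show "y \<in> {y. p * \<sigma> y = \<sigma> p' * y}"
    by simp
qed

text \<open>The constant \<open>c\<close> lies on the line, an additive subgroup, so translation by
  \<open>c\<close> preserves it.\<close>

lemma range_affine_eq_line:
  assumes "p' \<noteq> 0" and "p * \<sigma> p = p' * \<sigma> p'" and c: "p * \<sigma> c = \<sigma> p' * c"
  shows "range (\<lambda>x. p * \<sigma> x + p' * x + c) = {y. p * \<sigma> y = \<sigma> p' * y}"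
proof -
  have "range (\<lambda>x. p * \<sigma> x + p' * x + c) = (\<lambda>y. y + c) ` range (\<lambda>x. p * \<sigma> x + p' * x)"
    by (simp add: image_image)
  also have "\<dots> = (\<lambda>y. y + c) ` {y. p * \<sigma> y = \<sigma> p' * y}"
    using assms by (simp add: range_eq_line)
  also have "\<dots> = {y. p * \<sigma> y = \<sigma> p' * y}"
    using c by (auto simp: algebra_simps intro!: image_eqI[of _ _ "_ - c"])
  finally show ?thesis .
qed

lemma norm_eq_imp_cross_eq:
  assumes "a * \<sigma> a = b * \<sigma> b"
  shows "a * \<sigma> (a * \<sigma> u - b * \<sigma> v) = \<sigma> b * (b * u - a * v)"
  using assms by (simp add: algebra_simps)

text \<open>Keeping \<open>h\<close> arbitrary and writing \<open>A * \<sigma> (h y)\<close> avoids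
  negative powers of \<open>A\<close>.\<close>

lemma bij_iff_bij_betw_line:
  fixes a b c u v :: 'a and h :: "'a \<Rightarrow> 'a"
  defines "A \<equiv> b * u - a * v" and "B \<equiv> a * \<sigma> u - b * \<sigma> v" and "N \<equiv> u * \<sigma> u - v * \<sigma> v"
    and "L \<equiv> \<lambda>x. a * \<sigma> x + b * x + c"
  assumes fin: "finite (UNIV :: 'a set)"
    and ab: "a \<noteq> 0" "b \<noteq> 0"
    and norm: "a * \<sigma> a = b * \<sigma> b" and c: "a * \<sigma> c = \<sigma> b * c"
  shows "bij (\<lambda>x. h (L x) + u * \<sigma> x + v * x) \<longleftrightarrow>
    bij_betw (\<lambda>y. B * h y + A * \<sigma> (h y) + N * y) (range L) (range L)"
    (is "bij ?f \<longleftrightarrow> bij_betw ?g _ _")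
proof -
  define S where "S = {y. a * \<sigma> y = \<sigma> b * y}"
  have range_L: "range L = S"
    unfolding L_def S_def using ab(2) norm c by (rule range_affine_eq_line)
  have finS: "finite S"
    using fin by (rule rev_finite_subset) simp
  have aA: "\<sigma> A * a = \<sigma> b * B"
    using norm unfolding A_def B_def by (simp add: algebra_simps)
  have aB: "a * \<sigma> B = \<sigma> b * A"
    using norm unfolding A_def B_def by (rule norm_eq_imp_cross_eq)
  \<comment> \<open>The coefficients satisfy \<open>A * \<sigma> v + B * u = a * N\<close> and
    \<open>A * \<sigma> u + B * v = b * N\<close>, so the linear part of \<open>?f x\<close> is sent
    to \<open>N * (L x - c)\<close>; the constant \<open>N * c\<close> completes it to
    \<open>N * L x\<close>.\<close>
  define \<psi> where "\<psi> = (\<lambda>z. A * \<sigma> z + B * z + N * c)"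
  have psi_f: "\<psi> (?f x) = ?g (L x)" for x
    unfolding \<psi>_def A_def B_def N_def L_def by (simp add: algebra_simps)
  \<comment> \<open>On differences within a fibre of \<open>L\<close>, the linear part of
    \<open>?f\<close> acts as the scalar \<open>- A / a\<close>; hence the case split on
    \<open>A\<close>.\<close>
  have kernel: "a * (u * \<sigma> t + v * t) = - A * t" if "a * \<sigma> t + b * t = 0" for t
  proof -
    have "a * (u * \<sigma> t + v * t) = u * (a * \<sigma> t + b * t) - A * t"
      unfolding A_def by (simp add: algebra_simps)
    then show ?thesis
      using that by simp
  qed
  show ?thesis
  proof (cases "A = 0")
    case True
    obtain t where t: "t \<noteq> 0" "a * \<sigma> t + b * t = 0"
      using kernel_nontrivial ab norm by blast
    have "L t = L 0"
      using t by (simp add: L_def)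
    moreover have "u * \<sigma> t + v * t = 0"
      using kernel[OF t(2)] True ab by simp
    ultimately have "?f t = ?f 0"
      by (simp add: add.assoc)
    then have not_f: "\<not> bij ?f"
      using t(1) unfolding bij_def inj_def by blast
    \<comment> \<open>A nonzero point of \<open>S\<close>: together with 0 it shows that a constant
      map is not injective there.\<close>
    obtain y where y: "y \<noteq> 0" "a * \<sigma> y + (- \<sigma> b) * y = 0"
      using kernel_nontrivial[of a "- \<sigma> b"] ab norm by (auto simp: mult.commute)
    have B0: "B = 0"
      using aA True ab by simp
    have bu: "b * u = a * v"
      using True by (simp add: A_def)
    \<comment> \<open>Multiplying by the norm of \<open>b\<close> allows \<open>b * u\<close> to be
      replaced by \<open>a * v\<close>.\<close>
    have "b * \<sigma> b * N = (b * u) * \<sigma> (b * u) - b * \<sigma> b * (v * \<sigma> v)"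
      by (simp add: N_def algebra_simps)
    also have "\<dots> = (a * \<sigma> a - b * \<sigma> b) * (v * \<sigma> v)"
      unfolding bu by (simp add: algebra_simps)
    finally have "N = 0"
      using norm ab by simp
    then have g0: "?g = (\<lambda>y. 0)"
      using True B0 by simp
    have "y \<in> S" "0 \<in> S"
      using y by (auto simp: S_def)
    then have "\<not> bij_betw ?g (range L) (range L)"
      unfolding range_L bij_betw_def inj_on_def g0 using y(1) by blast
    with not_f show ?thesis
      by blast
  next
    case False
    have B: "B \<noteq> 0"
      using aA False ab by auto
    have "A * \<sigma> A * a = A * (\<sigma> b * B)"
      using aA by (simp add: mult.assoc)
    also have "\<dots> = B * \<sigma> B * a"
      using aB by (simp add: mult_ac)
    finally have normAB: "A * \<sigma> A = B * \<sigma> B"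
      using ab by simp
    \<comment> \<open>The two equations are proportional, so the range lemma applied to \<psi>
      yields the same line \<open>S\<close>.\<close>
    have line: "A * \<sigma> y = \<sigma> B * y \<longleftrightarrow> a * \<sigma> y = \<sigma> b * y" for y
    proof -
      have "a * (A * \<sigma> y - \<sigma> B * y) = A * (a * \<sigma> y - \<sigma> b * y)"
        using aB by (simp add: algebra_simps)
      then show ?thesis
        using False ab by (metis mult_eq_0_iff right_minus_eq)
    qed
    have "\<sigma> N = N"
      by (simp add: N_def mult.commute)
    then have "a * \<sigma> (N * c) = \<sigma> b * (N * c)"
      using c by (simp add: mult.left_commute)
    then have range_psi: "range \<psi> = S"
      unfolding \<psi>_def S_def line[symmetric]
      by (intro range_affine_eq_line B normAB)
    show ?thesis
      unfolding range_L
    proof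
      assume "bij ?f"
      \<comment> \<open>Surjectivity of \<open>?f\<close> makes \<open>?g\<close> map
        \<open>S\<close> onto itself; finiteness then gives injectivity.\<close>
      then have "S = range (\<lambda>x. \<psi> (?f x))"
        unfolding range_psi[symmetric] by (metis bij_def image_image)
      also have "\<dots> = ?g ` S"
        unfolding psi_f range_L[symmetric] by (simp add: image_image)
      finally show "bij_betw ?g S S"
        using finS by (metis bij_betw_def eq_card_imp_inj_on)
    next
      assume g: "bij_betw ?g S S"
      have "inj ?f"
      proof (rule injI)
        fix x y assume f: "?f x = ?f y"
        then have "?g (L x) = ?g (L y)"
          by (metis psi_f)
        then have L: "L x = L y"
          using g range_L unfolding bij_betw_def inj_on_def by blast
        then have "a * \<sigma> (x - y) + b * (x - y) = 0"
          by (simp add: L_def algebra_simps)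
        then have "- A * (x - y) = a * (u * \<sigma> (x - y) + v * (x - y))"
          by (rule kernel[symmetric])
        also have "u * \<sigma> (x - y) + v * (x - y) = 0"
          using f L by (simp add: algebra_simps)
        finally show "x = y"
          using False by simp
      qed
      then show "bij ?f"
        using fin by (simp add: bij_def finite_UNIV_inj_surj)
    qed
  qed
qed

end

section \<open>The Frobenius involution of a field with \<open>q\<^sup>2\<close> elements\<close>

lemma power_CARD_eq_same:
  fixes x :: "'a::{finite, field}"
  shows "x ^ CARD('a) = x"
proof (cases "x = 0")
  case False
  \<comment> \<open>Multiplication by \<open>x\<close> permutes the nonzero elements, and their
    product can be cancelled.\<close>
  have "(\<Prod>y\<in>- {0}. y) = (\<Prod>y\<in>- {0}. x * y)"
    using False by (intro prod.reindex_bij_witness[of _ "\<lambda>y. x * y" "\<lambda>y. y / x"]) auto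
  also have "\<dots> = x ^ (CARD('a) - 1) * (\<Prod>y\<in>- {0}. y)"
    by (simp add: prod.distrib Compl_eq_Diff_UNIV card_Diff_singleton)
  finally have "x ^ (CARD('a) - 1) = 1"
    by (simp add: prod_zero_iff)
  then show ?thesis
    by (metis finite_UNIV_card_ge_0 finite mult_1_right power_minus_mult mult.commute)
qed simp

lemma of_nat_CARD_eq_0: "of_nat CARD('a) = (0 :: 'a::{finite, ring_1})"
proof -
  have "(\<Sum>y\<in>UNIV. y) = (\<Sum>y\<in>UNIV. y + (1 :: 'a))"
    by (rule sum.reindex_bij_witness[of _ "\<lambda>y. y + 1" "\<lambda>y. y - 1"]) auto
  then show ?thesis
    by (simp add: sum.distrib)
qed

lemma field_involution_Frobenius:
  assumes q: "primepow q" and card: "CARD('a::{finite, field}) = q\<^sup>2"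
  shows "field_involution (\<lambda>x::'a. x ^ q)"
proof
  obtain p k where pk: "prime p" "k > 0" "q = p ^ k"
    using q unfolding primepow_def by blast
  have prime: "prime CHAR('a)"
    by (intro prime_CHAR_semidom finite_imp_CHAR_pos) simp
  \<comment> \<open>Since \<open>q\<^sup>2\<close> is 0 in the field, the characteristic is
    \<open>p\<close>, so \<open>q\<close> is one of its powers and raising to it is
    additive.\<close>
  have "CHAR('a) dvd p ^ (k * 2)"
    using of_nat_CARD_eq_0[where 'a = 'a] card pk(3) by (simp add: of_nat_eq_0_iff_char_dvd power_mult del: of_nat_power)
  then have "CHAR('a) = p"
    using prime pk(1) by (metis prime_dvd_power primes_dvd_imp_eq)
  then show "(x + y) ^ q = x ^ q + y ^ q" for x y :: 'a
    using prime pk(3) by (intro freshmans_dream') auto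
  show "(x * y) ^ q = x ^ q * y ^ q" for x y :: 'a
    by (rule power_mult_distrib)
  show "(x ^ q) ^ q = x" for x :: 'a
    using power_CARD_eq_same[of x] card by (simp add: power2_eq_square power_mult)
  have q1: "q > 1"
    using primepow_gt_Suc_0[OF q] by simp
  show "\<exists>w::'a. w ^ q \<noteq> w"
  proof (rule ccontr)
    assume "\<not> ?thesis"
    then have all: "w ^ q = w" for w :: 'a
      by blast
    \<comment> \<open>All \<open>q\<^sup>2\<close> field elements would be roots of a polynomial of
      degree at most \<open>q\<close>.\<close>
    define P :: "'a poly" where "P = monom 1 q - monom 1 1"
    have "coeff P q = 1"
      using q1 by (simp add: P_def)
    then have "P \<noteq> 0"
      by auto
    have "{x. poly P x = 0} = UNIV"
      using all by (simp add: P_def poly_monom)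
    then have "q\<^sup>2 \<le> degree P"
      using card_poly_roots_bound[OF \<open>P \<noteq> 0\<close>] card by simp
    also have "\<dots> \<le> q"
      unfolding P_def using q1 by (intro degree_diff_le) (auto simp: degree_monom_eq)
    finally show False
      using q1 by (simp add: power2_eq_square)
  qed
qed

section \<open>Specialisation to the polynomials \<open>f\<close> and \<open>g\<close>\<close>

theorem theorem1:
  fixes q d r :: nat
    and \<phi> L f g :: "'a::{finite, field} poly"
    and a b c u v A B :: 'a
    and S :: "'a set"
  assumes "primepow q" and "CARD('a) = q\<^sup>2"
    and "d > 0" and "d dvd q\<^sup>2 - 1" and "r > 0"
    and "a * b \<noteq> 0" and "a ^ (q + 1) = b ^ (q + 1)" and "a * c ^ q = b ^ q * c"
    and "A = b * u - a * v"
    and "B = a * u ^ q - b * v ^ q"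
    and "S = {a * x ^ q + b * x + c | x. x \<in> UNIV}"
    and "L = monom a q + monom b 1 + [:c:]"
    and "f = L ^ r * (\<phi> \<circ>\<^sub>p (L ^ ((q\<^sup>2 - 1) div d))) + monom u q + monom v 1"
    and "g = monom 1 r *
              (smult B (\<phi> \<circ>\<^sub>p monom 1 ((q\<^sup>2 - 1) div d))
               + smult (if A = 0 then 0 else A powi (1 - int r) * B ^ (q * r))
                   ((\<phi> \<circ>\<^sub>p monom 1 ((q\<^sup>2 - 1) div d)) ^ q))
            + monom (u ^ (q + 1) - v ^ (q + 1)) 1"
  shows "permutation_polynomial f \<longleftrightarrow> permutes_set g S"
proof -
  interpret field_involution "\<lambda>x::'a. x ^ q"
    using assms(1,2) by (rule field_involution_Frobenius)
  define s where "s = (q\<^sup>2 - 1) div d"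
  define h where "h y = y ^ r * poly \<phi> (y ^ s)" for y
  define K where "K = (if A = 0 then 0 else A powi (1 - int r) * B ^ (q * r))"
  have ab: "a \<noteq> 0" "b \<noteq> 0"
    using assms(6) by auto
  have norm: "a * a ^ q = b * b ^ q"
    using assms(7) by simp
  have S: "S = range (\<lambda>x. a * x ^ q + b * x + c)"
    using assms(11) by auto
  have f: "poly f = (\<lambda>x. h (a * x ^ q + b * x + c) + u * x ^ q + v * x)"
    unfolding assms(12,13) h_def s_def
    by (auto simp: fun_eq_iff poly_monom poly_pcompose)
  have g: "poly g y = B * h y + A * h y ^ q + (u * u ^ q - v * v ^ q) * y" if "y \<in> S" for y
  proof -
    have "y \<in> {y. a * y ^ q = b ^ q * y}"
      using that ab norm assms(8) unfolding S by (subst (asm) range_affine_eq_line) auto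
    then have y: "a * y ^ q = b ^ q * y"
      by simp
    \<comment> \<open>On the line \<open>B ^ q * y = A * y ^ q\<close>; in its \<open>r\<close>-th
      power the factor \<open>A ^ r\<close> meets \<open>A powi (1 - int r)\<close> and leaves a
      single \<open>A\<close>.\<close>
    have K: "K * y ^ r = A * (y ^ q) ^ r"
    proof (cases "A = 0")
      case True
      then show ?thesis
        by (simp add: K_def)
    next
      case False
      have "a * B ^ q = b ^ q * A"
        unfolding assms(9,10) using norm by (rule norm_eq_imp_cross_eq)
      then have "a * (B ^ q * y) = A * (b ^ q * y)"
        by (simp add: mult_ac)
      also have "\<dots> = a * (A * y ^ q)"
        unfolding y[symmetric] by (simp add: mult_ac)
      finally have "B ^ q * y = A * y ^ q"
        using ab by simp
      then have "B ^ (q * r) * y ^ r = A ^ r * (y ^ q) ^ r"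
        by (metis power_mult power_mult_distrib)
      moreover have "A powi (1 - int r) * A ^ r = A"
        using False by (simp add: power_int_diff)
      ultimately show ?thesis
        using False by (simp add: K_def mult.assoc)
    qed
    have "h y ^ q = (y ^ q) ^ r * poly \<phi> (y ^ s) ^ q"
      by (simp add: h_def power_mult_distrib mult.commute flip: power_mult)
    with K have "K * (y ^ r * poly \<phi> (y ^ s) ^ q) = A * h y ^ q"
      by (metis mult.assoc)
    moreover have "poly g y = B * h y + K * (y ^ r * poly \<phi> (y ^ s) ^ q) + (u * u ^ q - v * v ^ q) * y"
      unfolding assms(14) h_def s_def K_def[symmetric]
      by (simp add: poly_monom poly_pcompose distrib_left mult.left_commute)
    ultimately show ?thesis
      by simp
  qed
  have "permutation_polynomial f \<longleftrightarrow>
      bij_betw (\<lambda>y. B * h y + A * h y ^ q + (u * u ^ q - v * v ^ q) * y) S S"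
    unfolding permutation_polynomial_def f S assms(9,10)
    using ab norm assms(8) by (intro bij_iff_bij_betw_line) auto
  also have "\<dots> \<longleftrightarrow> permutes_set g S"
    unfolding permutes_set_def using g by (intro bij_betw_cong) simp
  finally show ?thesis .
qed

end
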